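(* Let $G$ and $H$ be connected graphs with $|V(G)|\geq 2$ and $|V(H)|\geq 2$. Then $$pc(G\Box H)\leq \min\{pc(G),pc(H)\}+1.$$ Moreover, the bound is sharp, i.e., there exist such graphs $G,H$ for which equality holds.
   Context: All graphs are simple, finite and undirected. In an edge-colored graph (adjacent edges may receive the same color), a path is a proper path if no two adjacent edges of the path have the same color. An edge-coloring of a connected graph is a proper-path coloring if every two distinct vertices are joined by a proper path. The proper connection number $pc(G)$ of a connected graph $G$ is the minimum number of colors in a proper-path coloring of $G$. The Cartesian product $G\Box H$ has vertex set $V(G)\times V(H)$, with $(g,h)$ adjacent to $(g',h')$ iff either $g=g'$ and $hh'\in E(H)$, or $h=h'$ and $gg'\in E(G)$. *)

theory Defs
  imports "Graph_Theory.Digraph_Component"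
begin

text \<open>
  Finite simple undirected graphs are the \<^locale>\<open>pair_graph\<close>s: finite, loop-free, symmetric
  digraphs without parallel arcs. An undirected edge \<open>uv\<close> is the pair of arcs \<open>(u, v)\<close>, \<open>(v, u)\<close>;
  colorings are defined on the unordered edges \<open>{u, v}\<close>, so both arcs get the same color.
\<close>

definition uedges :: "'a pair_pre_digraph \<Rightarrow> 'a set set" where
  "uedges G = {{u, v} | u v. (u, v) \<in> parcs G}"

definition proper_path ::
    "'a pair_pre_digraph \<Rightarrow> ('a set \<Rightarrow> 'c) \<Rightarrow> 'a \<Rightarrow> ('a \<times> 'a) list \<Rightarrow> 'a \<Rightarrow> bool" where
  "proper_path G c u p v \<longleftrightarrow>
     pre_digraph.apath (with_proj G) u p v \<and> distinct_adj (map (\<lambda>(x, y). c {x, y}) p)"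

definition proper_path_coloring :: "'a pair_pre_digraph \<Rightarrow> ('a set \<Rightarrow> 'c) \<Rightarrow> bool" where
  "proper_path_coloring G c \<longleftrightarrow>
     (\<forall>u \<in> pverts G. \<forall>v \<in> pverts G. u \<noteq> v \<longrightarrow> (\<exists>p. proper_path G c u p v))"

text \<open>
  Only meaningful for connected graphs. Natural numbers suffice as colors since the graphs are
  finite, and only colors actually occurring on an edge are counted.
\<close>

definition pc :: "'a pair_pre_digraph \<Rightarrow> nat" where
  "pc G = (LEAST k. \<exists>c :: 'a set \<Rightarrow> nat. proper_path_coloring G c \<and> card (c ` uedges G) = k)"

definition cart_prod ::
    "'a pair_pre_digraph \<Rightarrow> 'b pair_pre_digraph \<Rightarrow> ('a \<times> 'b) pair_pre_digraph"
    (infixl "\<box>" 70) where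
  "G \<box> H =
     \<lparr> pverts = pverts G \<times> pverts H,
       parcs = {((g, h), (g', h')) | g h g' h'.
         g \<in> pverts G \<and> h \<in> pverts H \<and> g' \<in> pverts G \<and> h' \<in> pverts H \<and>
         (g = g' \<and> (h, h') \<in> parcs H \<or> h = h' \<and> (g, g') \<in> parcs G)} \<rparr>"

lemma pair_graph_cart_prod:
  assumes "pair_graph G" and "pair_graph H"
  shows "pair_graph (G \<box> H)"
proof -
  interpret G: pair_graph G by fact
  interpret H: pair_graph H by fact
  have fin: "finite (pverts G \<times> pverts H)"
    using G.pair_finite_verts H.pair_finite_verts by blast
  have "parcs (G \<box> H) \<subseteq> (pverts G \<times> pverts H) \<times> (pverts G \<times> pverts H)"
    by (auto simp: cart_prod_def)
  then have "finite (parcs (G \<box> H))"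
    using fin by (meson finite_SigmaI finite_subset)
  moreover have "symmetric (with_proj (G \<box> H))"
    using G.pair_sym_arcs H.pair_sym_arcs
    by (auto simp: symmetric_def sym_def cart_prod_def)
  ultimately show ?thesis
    using fin G.pair_no_loops H.pair_no_loops
    by unfold_locales (auto simp: cart_prod_def)
qed

lemma ex_proper_path_coloring:
  fixes G :: "'a pair_pre_digraph"
  assumes "pair_graph G" and "Digraph_Component.connected (with_proj G)"
  shows "\<exists>c :: 'a set \<Rightarrow> nat. proper_path_coloring G c"
proof -
  interpret G: pair_graph G by fact
  have "uedges G \<subseteq> (\<lambda>(u, v). {u, v}) ` parcs G"
    by (auto simp: uedges_def)
  then have "finite (uedges G)"
    by (rule finite_subset) (rule finite_imageI[OF G.pair_finite_arcs])
  then obtain c :: "'a set \<Rightarrow> nat" where c: "inj_on c (uedges G)"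
    by (metis finite_imp_inj_to_nat_seg)
  have adj: "distinct_adj (map (\<lambda>(x, y). c {x, y}) p)"
    if "set p \<subseteq> parcs G" "pcas u p v" "distinct (pawalk_verts u p)" for u p v
    using that
  proof (induction p arbitrary: u)
    case (Cons e p)
    show ?case
    proof (cases p)
      case p: (Cons f q)
      obtain x y z where e: "e = (x, y)" "f = (y, z)"
        using Cons.prems(2) p by (cases e; cases f) auto
      have "z \<in> set (pawalk_verts z q)"
        using Cons.prems(2) p e by (cases q) auto
      then have "{x, y} \<noteq> {y, z}"
        using Cons.prems(3) p e by (auto simp: doubleton_eq_iff)
      moreover have "{x, y} \<in> uedges G" "{y, z} \<in> uedges G"
        using Cons.prems(1) p e by (auto simp: uedges_def)
      ultimately have "c {x, y} \<noteq> c {y, z}"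
        using inj_onD[OF c] by blast
      moreover have "distinct_adj (map (\<lambda>(x, y). c {x, y}) p)"
        using Cons.prems by (intro Cons.IH[of "snd e"]) auto
      ultimately show ?thesis by (simp add: p e)
    qed simp
  qed simp
  have "\<exists>p. proper_path G c u p v" if uv: "u \<in> pverts G" "v \<in> pverts G" for u v
  proof -
    have "(y, x) \<in> parcs G" if "(x, y) \<in> parcs G" for x y
      using G.pair_sym_arcs that by (simp add: symmetric_def sym_def)
    then have "parcs (mk_symmetric (with_proj G)) = parcs G"
      unfolding mk_symmetric_def by auto
    then have "mk_symmetric (with_proj G) = G"
      by (simp add: mk_symmetric_def)
    then have "u \<rightarrow>\<^sup>*\<^bsub>with_proj G\<^esub> v"
      using assms(2) uv by (simp add: connected_def strongly_connected_def)
    then obtain p where p: "G.apath u p v"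
      unfolding G.reachable_apath by blast
    moreover have "distinct_adj (map (\<lambda>(x, y). c {x, y}) p)"
      using p adj[of p u v] by (simp add: G.apath_def G.awalk_def)
    ultimately show ?thesis unfolding proper_path_def by blast
  qed
  then show ?thesis unfolding proper_path_coloring_def by blast
qed

end

theory Submission
  imports Defs
begin

text \<open>
  Color the edges in the copies of \<open>G\<close> by an optimal coloring of \<open>G\<close> and those in the copies of \<open>H\<close>
  by one new color. A walk alternating between the two kinds of edges is then proper, so a path in
  \<open>H\<close> can be lifted by swinging along a single edge \<open>xy\<close> of \<open>G\<close> between consecutive \<open>H\<close>-steps. If
  \<open>xy\<close> is the first edge of a proper path in \<open>G\<close>, then whichever of \<open>x\<close>, \<open>y\<close> is reached in the last
  copy of \<open>G\<close>, the rest of that path completes the lift. Equality holds for the 4-cycle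
  \<open>K2 \<box> K2\<close>.
\<close>

section \<open>Proper paths as lists of pairs, and their images under injective maps\<close>

text \<open>Unfolds \<open>apath\<close> of the projected digraph into conditions on lists, so that
  paths can be built and taken apart by simplification outside any digraph locale.\<close>

lemma proper_path_iff:
  "proper_path G c u p v \<longleftrightarrow>
     u \<in> pverts G \<and> set p \<subseteq> parcs G \<and> pcas u p v \<and> distinct (pawalk_verts u p) \<and>
     distinct_adj (map (\<lambda>(x, y). c {x, y}) p)"
  by (auto simp: proper_path_def pre_digraph.apath_def pre_digraph.awalk_def
      cas_with_proj_eq awalk_verts_with_proj_eq)

lemma pawalk_verts_Cons_hd: "pcas u p v \<Longrightarrow> pawalk_verts u p = u # tl (pawalk_verts u p)"
  by (cases p) auto

text \<open>Injectivity keeps the vertices distinct, and the list of colors along the path does not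
  change at all. The map is later the embedding of a factor as a layer or the swap of the two
  coordinates.\<close>

lemma proper_path_map:
  assumes p: "proper_path G c u p v"
    and verts: "f ` pverts G \<subseteq> pverts K"
    and arcs: "\<And>x y. (x, y) \<in> parcs G \<Longrightarrow> (f x, f y) \<in> parcs K"
    and colors: "\<And>x y. (x, y) \<in> parcs G \<Longrightarrow> d {f x, f y} = c {x, y}"
    and inj: "inj f"
  shows "proper_path K d (f u) (map (map_prod f f) p) (f v)"
    and "pawalk_verts (f u) (map (map_prod f f) p) = map f (pawalk_verts u p)"
proof -
  have cas: "pcas (f u) (map (map_prod f f) p) (f v) \<and>
      pawalk_verts (f u) (map (map_prod f f) p) = map f (pawalk_verts u p)"
    if "pcas u p v" for u p
    using that by (induction p arbitrary: u) auto
  have arcs_p: "set p \<subseteq> parcs G" and cas_p: "pcas u p v" and u: "u \<in> pverts G"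
    and dist: "distinct (pawalk_verts u p)" and adj: "distinct_adj (map (\<lambda>(x, y). c {x, y}) p)"
    using p by (auto simp: proper_path_iff)
  have map_eq: "map (\<lambda>(x, y). d {x, y}) (map (map_prod f f) p) = map (\<lambda>(x, y). c {x, y}) p"
    using arcs_p colors by auto
  have "distinct (map f (pawalk_verts u p))"
    using dist inj_on_subset[OF inj subset_UNIV] by (simp add: distinct_map)
  then show "proper_path K d (f u) (map (map_prod f f) p) (f v)"
    using cas[OF cas_p] u verts arcs arcs_p adj unfolding proper_path_iff map_eq by auto
  show "pawalk_verts (f u) (map (map_prod f f) p) = map f (pawalk_verts u p)"
    using cas[OF cas_p] by simp
qed

lemma proper_path_Cons:
  assumes "pair_graph G" "(u, w) \<in> parcs G" "proper_path G c w p v" "u \<notin> set (pawalk_verts w p)"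
    and "p \<noteq> [] \<Longrightarrow> c {u, w} \<noteq> c {fst (hd p), snd (hd p)}"
  shows "proper_path G c u ((u, w) # p) v"
proof -
  interpret pair_graph G by fact
  show ?thesis
    using assms in_arcsD1[of u w]
    by (cases p) (auto simp: proper_path_iff)
qed

section \<open>Finiteness of edge sets and attainment of the proper connection number\<close>

lemma finite_uedges:
  assumes "pair_graph G"
  shows "finite (uedges G)"
proof -
  interpret pair_graph G by fact
  have "uedges G = (\<lambda>(u, v). {u, v}) ` parcs G"
    by (auto simp: uedges_def)
  then show ?thesis
    using pair_finite_arcs by simp
qed

lemma pc_le_card:
  assumes "proper_path_coloring G (c :: _ \<Rightarrow> nat)"
  shows "pc G \<le> card (c ` uedges G)"
  unfolding pc_def using assms by (auto intro: Least_le)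

text \<open>The \<open>LEAST\<close> in \<open>pc\<close> says something only if some proper-path
  coloring exists, hence the assumption.\<close>

lemma pc_attained:
  fixes G :: "'a pair_pre_digraph"
  assumes "\<exists>c :: 'a set \<Rightarrow> nat. proper_path_coloring G c"
  obtains c :: "'a set \<Rightarrow> nat" where "proper_path_coloring G c" "card (c ` uedges G) = pc G"
proof -
  have "\<exists>k. \<exists>c :: 'a set \<Rightarrow> nat. proper_path_coloring G c \<and> card (c ` uedges G) = k"
    using assms by blast
  from LeastI_ex[OF this] show ?thesis
    using that unfolding pc_def by blast
qed

section \<open>Lifting proper paths to the Cartesian product\<close>

text \<open>A copy of \<open>G\<close> inside the product carries the coloring \<open>c\<close>. The
  vertex list is recorded too, since it shows that the lifted path never leaves the layer
  \<open>h\<close>.\<close>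

lemma proper_path_layer:
  fixes G :: "'a pair_pre_digraph" and H :: "'b pair_pre_digraph"
  assumes "pair_graph G" and p: "proper_path G c x p y" and h: "h \<in> pverts H"
    and color: "\<And>x y. (x, y) \<in> parcs G \<Longrightarrow> d {(x, h), (y, h)} = c {x, y}"
  defines "f \<equiv> \<lambda>g. (g, h)"
  shows "proper_path (G \<box> H) d (x, h) (map (map_prod f f) p) (y, h)"
    and "pawalk_verts (x, h) (map (map_prod f f) p) = map f (pawalk_verts x p)"
proof -
  interpret pair_graph G by fact
  have f: "f ` pverts G \<subseteq> pverts (G \<box> H)"
    "\<And>a b. (a, b) \<in> parcs G \<Longrightarrow> (f a, f b) \<in> parcs (G \<box> H)"
    "\<And>a b. (a, b) \<in> parcs G \<Longrightarrow> d {f a, f b} = c {a, b}" "inj f"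
    using h by (auto simp: f_def cart_prod_def inj_def color dest: in_arcsD1 in_arcsD2)
  show "proper_path (G \<box> H) d (x, h) (map (map_prod f f) p) (y, h)"
    and "pawalk_verts (x, h) (map (map_prod f f) p) = map f (pawalk_verts x p)"
    using proper_path_map[OF p f] by (simp_all add: f_def)
qed

text \<open>The invariant that only the start vertex of the zigzag projects to the start of \<open>q\<close> keeps the
  zigzag from meeting the \<open>G\<close>-edge prepended to it.\<close>

lemma zigzag_proper_path:
  fixes G :: "'a pair_pre_digraph" and H :: "'b pair_pre_digraph"
  assumes graphs: "pair_graph G" "pair_graph H"
    and G_color: "\<And>x y h. (x, y) \<in> parcs G \<Longrightarrow> d {(x, h), (y, h)} = c {x, y}"
    and H_color: "\<And>g x y. (x, y) \<in> parcs H \<Longrightarrow> d {(g, x), (g, y)} = new"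
    and new: "new \<notin> c ` uedges G"
  shows "q \<noteq> [] \<Longrightarrow> set q \<subseteq> parcs H \<Longrightarrow> pcas h q h' \<Longrightarrow> distinct (pawalk_verts h q) \<Longrightarrow>
    (x, y) \<in> parcs G \<Longrightarrow> proper_path G c x p g' \<Longrightarrow> proper_path G c y p' g' \<Longrightarrow>
    \<exists>w r. (h, w) \<in> parcs H \<and> proper_path (G \<box> H) d (x, h) (((x, h), (x, w)) # r) (g', h') \<and>
      snd ` set (pawalk_verts (x, w) r) \<subseteq> set (tl (pawalk_verts h q))"
proof (induction q arbitrary: h x y p p')
  case (Cons e q)
  interpret G: pair_graph G by fact
  interpret H: pair_graph H by fact
  note K = pair_graph_cart_prod[OF graphs]
  obtain w where e: "e = (h, w)" and hw: "(h, w) \<in> parcs H" and q: "pcas w q h'"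
    "set q \<subseteq> parcs H" "distinct (pawalk_verts w q)" "h \<notin> set (pawalk_verts w q)"
    using Cons.prems by (cases e) auto
  have hw_verts: "h \<in> pverts H" "w \<in> pverts H"
    using H.in_arcsD1[of h w] H.in_arcsD2[of h w] hw by auto
  have xy_verts: "x \<in> pverts G" "y \<in> pverts G"
    using G.in_arcsD1[of x y] G.in_arcsD2[of x y] Cons.prems(5) by auto
  have yx: "(y, x) \<in> parcs G"
    using Cons.prems(5) G.pair_sym_arcs by (simp add: symmetric_def sym_def)
  \<comment> \<open>A \<open>G\<close>-edge and an \<open>H\<close>-edge that follow each other
    never share a color.\<close>
  have new_G: "d {(a, z), (b, z)} \<noteq> new" if "(a, b) \<in> parcs G" for a b z
    using new that G_color[OF that] by (force simp: uedges_def)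
  have H_arc: "((x, h), (x, w)) \<in> parcs (G \<box> H)"
    using hw hw_verts xy_verts by (auto simp: cart_prod_def)
  show ?case
  proof (cases "q = []")
    case True
    then have w: "w = h'" using q by simp
    \<comment> \<open>The only \<open>H\<close>-step left enters the last copy of \<open>G\<close>,
      where the path \<open>p\<close> from the current vertex \<open>x\<close> finishes the walk.
      That copy avoids \<open>(x, h)\<close> because \<open>H\<close> has no loops.\<close>
    let ?f = "\<lambda>g. (g, h')"
    have f: "proper_path (G \<box> H) d (x, h') (map (map_prod ?f ?f) p) (g', h')"
      "pawalk_verts (x, h') (map (map_prod ?f ?f) p) = map ?f (pawalk_verts x p)"
      using proper_path_layer[OF graphs(1) Cons.prems(6) hw_verts(2) G_color] w by simp_all
    have "proper_path (G \<box> H) d (x, h) (((x, h), (x, h')) # map (map_prod ?f ?f) p) (g', h')"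
    proof (rule proper_path_Cons[OF K])
      assume "map (map_prod ?f ?f) p \<noteq> []"
      then obtain a b p2 where p: "p = (a, b) # p2" by (cases p) auto
      then show "d {(x, h), (x, h')} \<noteq>
          d {fst (hd (map (map_prod ?f ?f) p)), snd (hd (map (map_prod ?f ?f) p))}"
        using new_G[of a b h'] Cons.prems(6) H_color[OF hw] w by (force simp: proper_path_iff)
    qed (use f H_arc w H.pair_no_loops[OF hw] in auto)
    then show ?thesis
      using f(2) hw w e True by (intro exI[of _ h'] exI[of _ "map (map_prod ?f ?f) p"]) auto
  next
    case False
    \<comment> \<open>The induction hypothesis is applied with \<open>x\<close> and
      \<open>y\<close>, and likewise \<open>p\<close> and \<open>p'\<close>, exchanged: after
      swinging along \<open>xy\<close>, the zigzag continues from \<open>y\<close>.\<close>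
    obtain z r where wz: "(w, z) \<in> parcs H"
      and r: "proper_path (G \<box> H) d (y, w) (((y, w), (y, z)) # r) (g', h')"
        "snd ` set (pawalk_verts (y, z) r) \<subseteq> set (tl (pawalk_verts w q))"
      using Cons.IH[OF False q(2,1,3) yx Cons.prems(7,6)] by blast
    let ?r = "((y, w), (y, z)) # r"
    have walk: "pawalk_verts w q = w # tl (pawalk_verts w q)"
      using pawalk_verts_Cons_hd[OF q(1)] .
    have w: "w \<notin> set (tl (pawalk_verts w q))"
      using q(3) walk by (metis distinct.simps(2))
    have tl: "set (tl (pawalk_verts w q)) \<subseteq> set (pawalk_verts w q)" "w \<in> set (pawalk_verts w q)"
      using walk by (metis set_subset_Cons, metis list.set_intros(1))
    \<comment> \<open>Prepending the swing is proper because the path from the induction hypothesis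
      visibly begins with an \<open>H\<close>-arc. Only its start \<open>(y, w)\<close> lies in
      layer \<open>w\<close>, so \<open>(x, w)\<close> is not on it.\<close>
    have 1: "proper_path (G \<box> H) d (x, w) (((x, w), (y, w)) # ?r) (g', h')"
    proof (rule proper_path_Cons[OF K _ r(1)])
      show "((x, w), (y, w)) \<in> parcs (G \<box> H)"
        using hw_verts xy_verts Cons.prems(5) by (auto simp: cart_prod_def)
      have "(x, w) \<notin> set (pawalk_verts (y, z) r)"
        using r(2) w by force
      then show "(x, w) \<notin> set (pawalk_verts (y, w) ?r)"
        using G.pair_no_loops[OF Cons.prems(5)] by simp
    qed (use new_G[OF Cons.prems(5), of w] H_color[OF wz, of y] in auto)
    \<comment> \<open>All later vertices project to vertices of \<open>q\<close>, and
      \<open>h\<close> is not among these.\<close>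
    have "proper_path (G \<box> H) d (x, h) (((x, h), (x, w)) # ((x, w), (y, w)) # ?r) (g', h')"
    proof (rule proper_path_Cons[OF K H_arc 1])
      have "snd ` set (pawalk_verts (x, w) (((x, w), (y, w)) # ?r)) \<subseteq> set (pawalk_verts w q)"
        using r(2) tl by auto
      then show "(x, h) \<notin> set (pawalk_verts (x, w) (((x, w), (y, w)) # ?r))"
        using q(4) by force
    qed (use new_G[OF Cons.prems(5), of w] H_color[OF hw, of x] in auto)
    moreover have "snd ` set (pawalk_verts (x, w) (((x, w), (y, w)) # ?r))
        \<subseteq> set (tl (pawalk_verts h (e # q)))"
      using r(2) tl e by auto
    ultimately show ?thesis using hw by blast
  qed
qed simp

section \<open>Simple paths and neighbours in connected graphs\<close>

text \<open>A proper path for any proper-path coloring is in particular a simple path. Equal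
  endpoints are treated apart, since a coloring only promises paths between distinct
  vertices.\<close>

lemma connected_imp_path:
  fixes G :: "'a pair_pre_digraph"
  assumes "pair_graph G" "Digraph_Component.connected (with_proj G)" "u \<in> pverts G" "v \<in> pverts G"
  obtains p where "set p \<subseteq> parcs G" "pcas u p v" "distinct (pawalk_verts u p)"
proof (cases "u = v")
  case True
  then show ?thesis using that[of "[]"] by simp
next
  case False
  obtain c :: "'a set \<Rightarrow> nat" where "proper_path_coloring G c"
    using ex_proper_path_coloring[OF assms(1,2)] by blast
  then obtain p where "proper_path G c u p v"
    using False assms(3,4) unfolding proper_path_coloring_def by blast
  then show ?thesis
    using that[of p] by (simp add: proper_path_iff)
qed

lemma connected_ex_neighbour:
  assumes G: "pair_graph G" "Digraph_Component.connected (with_proj G)"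
    and card: "card (pverts G) \<ge> 2" and u: "u \<in> pverts G"
  obtains v where "(u, v) \<in> parcs G"
proof -
  have "\<not> pverts G \<subseteq> {u}"
    using card card_mono[of "{u}" "pverts G"] by auto
  then obtain v where v: "v \<in> pverts G" "u \<noteq> v" by blast
  obtain p where p: "set p \<subseteq> parcs G" "pcas u p v" "distinct (pawalk_verts u p)"
    using connected_imp_path[OF G u v(1)] .
  then obtain w q where "p = (u, w) # q" using v(2) by (cases p) auto
  then show ?thesis using p(1) that[of w] by simp
qed

section \<open>Coloring the product with one extra color\<close>

text \<open>Vertices in the same copy of \<open>G\<close> are joined inside that copy, and vertices
  in different copies by a zigzag along an arbitrary simple path of \<open>H\<close>.\<close>

lemma proper_path_coloring_cart_prod:
  fixes G :: "'a pair_pre_digraph" and H :: "'b pair_pre_digraph"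
  assumes G: "pair_graph G" "Digraph_Component.connected (with_proj G)" "card (pverts G) \<ge> 2"
    and H: "pair_graph H" "Digraph_Component.connected (with_proj H)"
    and c: "proper_path_coloring G c"
    and G_color: "\<And>x y h. (x, y) \<in> parcs G \<Longrightarrow> d {(x, h), (y, h)} = c {x, y}"
    and H_color: "\<And>g x y. (x, y) \<in> parcs H \<Longrightarrow> d {(g, x), (g, y)} = new"
    and new: "new \<notin> c ` uedges G"
  shows "proper_path_coloring (G \<box> H) d"
  unfolding proper_path_coloring_def
proof (intro ballI impI)
  fix u v assume uv: "u \<in> pverts (G \<box> H)" "v \<in> pverts (G \<box> H)" "u \<noteq> v"
  interpret G: pair_graph G by fact
  obtain g h g' h' where eqs: "u = (g, h)" "v = (g', h')" by (cases u, cases v)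
  then have verts: "g \<in> pverts G" "h \<in> pverts H" "g' \<in> pverts G" "h' \<in> pverts H"
    using uv by (auto simp: cart_prod_def)
  show "\<exists>p. proper_path (G \<box> H) d u p v"
  proof (cases "h = h'")
    case True
    then obtain p where p: "proper_path G c g p g'"
      using c verts uv eqs unfolding proper_path_coloring_def by blast
    let ?f = "\<lambda>g. (g, h')"
    have "proper_path (G \<box> H) d (?f g) (map (map_prod ?f ?f) p) (?f g')"
      using proper_path_layer(1)[OF G(1) p verts(4) G_color] by simp
    then show ?thesis using eqs True by blast
  next
    case False
    obtain q where q: "set q \<subseteq> parcs H" "pcas h q h'" "distinct (pawalk_verts h q)"
      using connected_imp_path[OF H verts(2,4)] .
    have "q \<noteq> []" using q(2) False by auto
    \<comment> \<open>The swing edge \<open>gy\<close> must have a proper path to \<open>g'\<close>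
      from both ends. If \<open>g = g'\<close>, any neighbour \<open>y\<close> serves, with the
      empty path from \<open>g\<close> and the single edge back from \<open>y\<close>. Otherwise
      \<open>gy\<close> is the first edge of a proper path, and \<open>p'\<close> is its
      remainder.\<close>
    obtain y p p' where y: "(g, y) \<in> parcs G" "proper_path G c g p g'" "proper_path G c y p' g'"
    proof (cases "g = g'")
      case True
      obtain y where y: "(g, y) \<in> parcs G" using connected_ex_neighbour[OF G verts(1)] .
      then have "(y, g) \<in> parcs G" "y \<noteq> g" "y \<in> pverts G"
        using G.pair_sym_arcs G.pair_no_loops[OF y] G.in_arcsD2[of g y]
        by (auto simp: symmetric_def sym_def)
      then show ?thesis
        using that[of y "[]" "[(y, g)]"] y True verts by (simp add: proper_path_iff)
    next
      case False
      then obtain p where p: "proper_path G c g p g'"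
        using c verts unfolding proper_path_coloring_def by blast
      then obtain y p' where p': "p = (g, y) # p'"
        using False by (cases p) (auto simp: proper_path_iff)
      then have "proper_path G c y p' g'"
        using p G.in_arcsD2[of g y] by (cases p') (auto simp: proper_path_iff)
      then show ?thesis
        using that[of y p p'] p p' by (auto simp: proper_path_iff)
    qed
    show ?thesis
      using zigzag_proper_path[OF G(1) H(1) G_color H_color new \<open>q \<noteq> []\<close> q y] eqs by blast
  qed
qed

lemma ex_coloring_cart_prod:
  fixes G :: "'a pair_pre_digraph" and H :: "'b pair_pre_digraph"
  assumes G: "pair_graph G" "Digraph_Component.connected (with_proj G)" "card (pverts G) \<ge> 2"
    and H: "pair_graph H" "Digraph_Component.connected (with_proj H)"
  shows "\<exists>d :: ('a \<times> 'b) set \<Rightarrow> nat.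
    proper_path_coloring (G \<box> H) d \<and> card (d ` uedges (G \<box> H)) \<le> pc G + 1"
proof -
  interpret H: pair_graph H by fact
  obtain c :: "'a set \<Rightarrow> nat" where c: "proper_path_coloring G c" "card (c ` uedges G) = pc G"
    using pc_attained[OF ex_proper_path_coloring[OF G(1,2)]] .
  have fin: "finite (c ` uedges G)" using finite_uedges[OF G(1)] by simp
  then obtain new where new: "new \<notin> c ` uedges G" using ex_new_if_finite infinite_UNIV_nat by blast
  \<comment> \<open>The kind of an edge is read off from its second coordinates: they coincide on a
    \<open>G\<close>-edge, and then \<open>fst\<close> recovers the underlying edge of
    \<open>G\<close>. On an \<open>H\<close>-edge they differ, as \<open>H\<close> is
    loop-free.\<close>
  define d where "d e = (if card (snd ` e) = 1 then c (fst ` e) else new)" for e :: "('a \<times> 'b) set"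
  have G_color: "d {(x, h), (y, h)} = c {x, y}" for x y h
    by (simp add: d_def)
  have H_color: "d {(g, x), (g, y)} = new" if "(x, y) \<in> parcs H" for g x y
    using H.pair_no_loops[OF that] by (auto simp: d_def card_insert_if)
  have "d ` uedges (G \<box> H) \<subseteq> insert new (c ` uedges G)"
  proof
    fix k assume "k \<in> d ` uedges (G \<box> H)"
    then obtain g h g' h' where k: "k = d {(g, h), (g', h')}" and
      "g = g' \<and> (h, h') \<in> parcs H \<or> h = h' \<and> (g, g') \<in> parcs G"
      by (auto simp: uedges_def cart_prod_def)
    moreover have "{g, g'} \<in> uedges G" if "(g, g') \<in> parcs G"
      using that by (auto simp: uedges_def)
    ultimately show "k \<in> insert new (c ` uedges G)"
      using G_color[of g h g'] H_color[of h h' g] by auto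
  qed
  then have "card (d ` uedges (G \<box> H)) \<le> card (insert new (c ` uedges G))"
    using fin by (intro card_mono) auto
  also have "\<dots> = pc G + 1" using fin new c(2) by simp
  finally show ?thesis
    using proper_path_coloring_cart_prod[OF G H c(1) G_color H_color new] by blast
qed

section \<open>Symmetry in the factors, and bounds on the number of colors\<close>

text \<open>\<open>prod.swap\<close> is an isomorphism between the two products, and the coloring is
  pulled back along it.\<close>

lemma proper_path_coloring_cart_prod_swap:
  fixes G :: "'a pair_pre_digraph" and H :: "'b pair_pre_digraph"
  assumes c: "proper_path_coloring (H \<box> G) c"
  shows "proper_path_coloring (G \<box> H) (\<lambda>e. c (prod.swap ` e))"
  unfolding proper_path_coloring_def
proof (intro ballI impI)
  fix u v assume "u \<in> pverts (G \<box> H)" "v \<in> pverts (G \<box> H)" "u \<noteq> v"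
  then have "prod.swap u \<in> pverts (H \<box> G)" "prod.swap v \<in> pverts (H \<box> G)"
    "prod.swap u \<noteq> prod.swap v"
    by (auto simp: cart_prod_def)
  then obtain p where p: "proper_path (H \<box> G) c (prod.swap u) p (prod.swap v)"
    using c unfolding proper_path_coloring_def by blast
  have "proper_path (G \<box> H) (\<lambda>e. c (prod.swap ` e)) (prod.swap (prod.swap u))
      (map (map_prod prod.swap prod.swap) p) (prod.swap (prod.swap v))"
    by (rule proper_path_map[OF p]) (auto simp: cart_prod_def)
  then show "\<exists>p. proper_path (G \<box> H) (\<lambda>e. c (prod.swap ` e)) u p v" by auto
qed

text \<open>A path between distinct non-adjacent vertices has at least two edges, and its first two
  have different colors.\<close>

lemma two_le_card_colors:
  assumes G: "pair_graph G" and c: "proper_path_coloring G c"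
    and uv: "u \<in> pverts G" "v \<in> pverts G" "u \<noteq> v" "(u, v) \<notin> parcs G"
  shows "2 \<le> card (c ` uedges G)"
proof -
  obtain p where p: "proper_path G c u p v"
    using c uv unfolding proper_path_coloring_def by blast
  then obtain a b a' b' r where "p = (a, b) # (a', b') # r"
    using uv by (cases p; cases "tl p") (auto simp: proper_path_iff)
  then have "{c {a, b}, c {a', b'}} \<subseteq> c ` uedges G" "c {a, b} \<noteq> c {a', b'}"
    using p by (auto simp: proper_path_iff uedges_def)
  then show ?thesis
    using card_mono[of "c ` uedges G" "{c {a, b}, c {a', b'}}"] finite_uedges[OF G] by simp
qed

lemma pc_cart_prod_le:
  fixes G :: "'a pair_pre_digraph" and H :: "'b pair_pre_digraph"
  assumes G: "pair_graph G" "Digraph_Component.connected (with_proj G)" "card (pverts G) \<ge> 2"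
    and H: "pair_graph H" "Digraph_Component.connected (with_proj H)" "card (pverts H) \<ge> 2"
  shows "pc (G \<box> H) \<le> min (pc G) (pc H) + 1"
proof -
  have "pc (G \<box> H) \<le> pc G + 1"
    using ex_coloring_cart_prod[OF G H(1,2)] pc_le_card le_trans by blast
  moreover have "pc (G \<box> H) \<le> pc H + 1"
  proof -
    obtain d :: "('b \<times> 'a) set \<Rightarrow> nat" where d: "proper_path_coloring (H \<box> G) d"
        "card (d ` uedges (H \<box> G)) \<le> pc H + 1"
      using ex_coloring_cart_prod[OF H G(1,2)] by blast
    \<comment> \<open>Swapped edges are edges of \<open>H \<box> G\<close>, so pulling back creates
      no color that \<open>d\<close> does not already use.\<close>
    have "(\<lambda>e. d (prod.swap ` e)) ` uedges (G \<box> H) \<subseteq> d ` uedges (H \<box> G)"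
      by (fastforce simp: uedges_def cart_prod_def)
    then have "card ((\<lambda>e. d (prod.swap ` e)) ` uedges (G \<box> H)) \<le> card (d ` uedges (H \<box> G))"
      using finite_uedges[OF pair_graph_cart_prod[OF H(1) G(1)]] by (intro card_mono) auto
    then show ?thesis
      using pc_le_card[OF proper_path_coloring_cart_prod_swap[OF d(1)]] d(2) by linarith
  qed
  ultimately show ?thesis by simp
qed

section \<open>Sharpness: the 4-cycle as a product of two edges\<close>

definition K2 :: "nat pair_pre_digraph" where
  "K2 = \<lparr> pverts = {0, 1}, parcs = {(0, 1), (1, 0)} \<rparr>"

lemma pair_graph_K2: "pair_graph K2"
  by unfold_locales (auto simp: K2_def symmetric_def sym_def)

lemma connected_K2: "Digraph_Component.connected (with_proj K2)"
proof -
  interpret pair_graph K2 by (rule pair_graph_K2)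
  have "u \<rightarrow>\<^sup>*\<^bsub>with_proj K2\<^esub> v" if "u \<in> pverts K2" "v \<in> pverts K2" for u v
  proof (cases "u = v")
    case False
    then have "u \<rightarrow>\<^bsub>with_proj K2\<^esub> v" using that by (auto simp: K2_def)
    then show ?thesis by (intro reachable_adjI) simp
  qed (use that in auto)
  \<comment> \<open>\<open>connected\<close> refers to the symmetric closure, which here is the
    graph itself.\<close>
  moreover have "mk_symmetric (with_proj K2) = K2"
    by (auto simp: mk_symmetric_def K2_def)
  ultimately show ?thesis
    by (simp add: connected_def strongly_connected_def K2_def)
qed

text \<open>With a single edge, every coloring uses exactly one color, in particular an optimal
  one.\<close>

lemma pc_K2: "pc K2 = 1"
proof -
  obtain c :: "nat set \<Rightarrow> nat" where "card (c ` uedges K2) = pc K2"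
    using pc_attained[OF ex_proper_path_coloring[OF pair_graph_K2 connected_K2]] by blast
  moreover have "uedges K2 = {{0, 1}}" by (auto simp: uedges_def K2_def)
  ultimately show ?thesis by simp
qed

lemma pc_K2_cart_K2: "pc (K2 \<box> K2) = 2"
proof (rule antisym)
  have card: "card (pverts K2) \<ge> 2" by (simp add: K2_def)
  show "pc (K2 \<box> K2) \<le> 2"
    using pc_cart_prod_le[OF pair_graph_K2 connected_K2 card pair_graph_K2 connected_K2 card]
    by (simp add: pc_K2)
  have graph: "pair_graph (K2 \<box> K2)"
    using pair_graph_cart_prod[OF pair_graph_K2 pair_graph_K2] .
  have "\<exists>c :: (nat \<times> nat) set \<Rightarrow> nat. proper_path_coloring (K2 \<box> K2) c"
    using ex_coloring_cart_prod[OF pair_graph_K2 connected_K2 card pair_graph_K2 connected_K2]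
    by blast
  then obtain c :: "(nat \<times> nat) set \<Rightarrow> nat" where
    c: "proper_path_coloring (K2 \<box> K2) c" "card (c ` uedges (K2 \<box> K2)) = pc (K2 \<box> K2)"
    using pc_attained by blast
  \<comment> \<open>Opposite corners of the 4-cycle differ in both coordinates, hence are not
    adjacent.\<close>
  have "2 \<le> card (c ` uedges (K2 \<box> K2))"
    by (rule two_le_card_colors[OF graph c(1), of "(0, 0)" "(1, 1)"])
      (auto simp: cart_prod_def K2_def)
  then show "2 \<le> pc (K2 \<box> K2)" using c(2) by simp
qed

theorem theorem1:
  shows "(\<forall>(G :: 'a pair_pre_digraph) (H :: 'b pair_pre_digraph).
            pair_graph G \<and> Digraph_Component.connected (with_proj G) \<and> card (pverts G) \<ge> 2 \<and>
            pair_graph H \<and> Digraph_Component.connected (with_proj H) \<and> card (pverts H) \<ge> 2 \<longrightarrow>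
            pc (G \<box> H) \<le> min (pc G) (pc H) + 1)
       \<and> (\<exists>(G :: nat pair_pre_digraph) (H :: nat pair_pre_digraph).
            pair_graph G \<and> Digraph_Component.connected (with_proj G) \<and> card (pverts G) \<ge> 2 \<and>
            pair_graph H \<and> Digraph_Component.connected (with_proj H) \<and> card (pverts H) \<ge> 2 \<and>
            pc (G \<box> H) = min (pc G) (pc H) + 1)"
proof (intro conjI allI impI, goal_cases)
  case (1 G H)
  then show ?case using pc_cart_prod_le by blast
next
  case 2
  have "card (pverts K2) \<ge> 2" "pc (K2 \<box> K2) = min (pc K2) (pc K2) + 1"
    by (simp add: K2_def, simp add: pc_K2 pc_K2_cart_K2)
  then show ?case using pair_graph_K2 connected_K2 by blast
qed

end
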